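(* Define $$\alpha := 2\prod_{j=1}^{\infty}\left[\frac{s_{j+1}}{(s_j-1)^2}\right]^{2^{j-1}}$$ (a convergent product, $\alpha\doteq 5.522868$), where $(s_j)_{j\ge 0}$ is Sylvester's sequence. For each integer $n\geq 2$, let $1/m_n$ be the minimal log discrepancy of Esser's klt Calabi--Yau variety $V/\mu_{m_n}$ of dimension $n$, where $m_n$ is the explicit integer given in the context. Then $$\frac{1}{m_n}\leq \alpha \,\frac{1}{s_{n+1}-1}$$ if $n$ is even and $$\frac{1}{m_n}\leq\frac{3\alpha^2}{4}\,\frac{1}{s_{n+1}-1}$$ if $n$ is odd.
   Context: Sylvester's sequence: $s_0=2$, $s_{j+1}=s_j(s_j-1)+1$. Alternating sums: given integers $b_i$, write $$B_{i_1\cdots i_k} := b_{i_1}\cdots b_{i_k}-b_{i_1}\cdots b_{i_{k-1}}+\cdots+(-1)^{k-1}b_{i_1}+(-1)^k,$$ with $B=1$ for the empty subscript. Let $n=2r+1$ or $n=2r$ with $r\ge 1$. For $0\le i\le r$ let $b_i:=s_i$. Then define inductively $$b_{r+i} := 1+(b_{r+1-i}-1)^2B_{r+1,r,r+2,r-1,\ldots,r-1+i,r+2-i}$$ for $1\le i\le r+1$ when $n=2r+1$, and for $1\le i\le r$ when $n=2r$. (The subscript list is the concatenation of the pairs $(r+j,\,r+1-j)$ for $j=1,\ldots,i-1$; it is empty for $i=1$.) The number $m_n$: $m_{2r+1}:=B_{0,2r+1,1,2r,\ldots,r,r+1}$ and $m_{2r}:=B_{1,2r,2,2r-1,\ldots,r,r+1}$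 (subscript lists: concatenation of the pairs $(j,2r+1-j)$ for $j=0,\ldots,r$, resp. $j=1,\ldots,r$). Esser's variety: put $$v_{2r+1} := B_{r+1,r,\ldots,2r+1,0}-B_{r,\ldots,2r+1,0}+\cdots-B_0,\qquad v_{2r} := 2\left(B_{r+1,r,\ldots,2r,1}-B_{r,\ldots,2r,1}+\cdots-B_1\right)+1,$$ where the first subscript list is the concatenation of the pairs $(r+j,r+1-j)$ for $j=1,\ldots,r+1$ (resp. $j=1,\ldots,r$), and each successive term drops the first remaining index. For $n=2r+1$, $V\subset\mathbf{P}^{n+1}(a_0,\ldots,a_{n+1})$ (over $\mathbf{C}$) is defined by the sum of $x_i^{b_i}x_{2r+2-i}$ ($0\le i\le r$), $x_{r+j}^{b_{r+j}}x_{r+1-j}$ ($1\le j\le r+1$), and $x_{2r+2}^{v_{2r+1}}x_{r+1}$; for $n=2r$, by the sum of $x_0^{b_0}$, $x_i^{b_i}x_{2r+2-i}$ ($1\le i\le r$), $x_{r+j}^{b_{r+j}}x_{r+1-j}$ ($1\le j\le r$), and $x_{2r+1}^{v_{2r}}x_{r+1}$. The weights are the positive integers with gcd $1$ making the polynomial weighted-homogeneous. Let $\mathrm{Aut}_T(V)$ be the group of automorphisms of $V$ given by diagonal matrices. For $n$ odd it is cyclic of order $m_n$ and $\mu_{m_n}:=\mathrm{Aut}_T(V)$; for $n$ even, $m_n$ is odd, $\mathrm{Aut}_T(V)\cong\mu_2\times\mu_{m_n}$, and $\mu_{m_n}$ is the subgroup of order $m_n$. The quotient $V/\mu_{m_n}$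 is a klt Calabi--Yau variety whose minimal log discrepancy is $1/m_n$ with $m_n$ the explicit integer above. *)

theory Defs
  imports "HOL-Analysis.Analysis"
begin

fun sylvester :: "nat \<Rightarrow> int" where
  "sylvester 0 = 2"
| "sylvester (Suc j) = sylvester j * (sylvester j - 1) + 1"

text \<open>
  The alternating sum \<open>B\<^bsub>i\<^sub>1\<dots>i\<^sub>k\<^esub>\<close> takes the list of
  values \<open>[b\<^bsub>i\<^sub>1\<^esub>, \<dots>, b\<^bsub>i\<^sub>k\<^esub>]\<close> instead of the list of indices,
  so that it can be used inside the recursive definition of the numbers \<open>b\<^sub>i\<close>.
\<close>

definition alt_sum :: "int list \<Rightarrow> int" where
  "alt_sum bs = (\<Sum>l\<le>length bs. (-1) ^ (length bs - l) * prod_list (take l bs))"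

text \<open>
  \<open>esser_b r k\<close> is \<open>b\<^sub>k\<close> for dimension \<open>2 * r\<close> or \<open>2 * r + 1\<close>; the two
  sequences follow the same rule and differ only in where they stop. The second equation is
  the recursion for \<open>b\<^bsub>r+i\<^esub>\<close> with \<open>i = k - r\<close>. Only the values with
  \<open>k \<le> 2 * r + 1\<close> are meaningful.
\<close>

function esser_b :: "nat \<Rightarrow> nat \<Rightarrow> int" where
  "k \<le> r \<Longrightarrow> esser_b r k = sylvester k"
| "r < k \<Longrightarrow> esser_b r k =
     1 + (esser_b r (r + 1 - (k - r)) - 1)\<^sup>2 *
       alt_sum (map (esser_b r) (concat (map (\<lambda>j. [r + j, r + 1 - j]) [1..<k - r])))"
  by (atomize_elim, auto)
termination
  by (relation "Wellfounded.measure snd") auto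

definition esser_m :: "nat \<Rightarrow> int" where
  "esser_m n = (let r = n div 2 in
     alt_sum (map (esser_b r)
       (concat (map (\<lambda>j. [j, 2 * r + 1 - j]) [(if odd n then 0 else 1)..<r + 1]))))"

text \<open>
  The product in the definition of \<open>\<alpha>\<close> starts at \<open>j = 1\<close>; the index below is
  \<open>j - 1\<close>.
\<close>

definition esser_factor :: "nat \<Rightarrow> real" where
  "esser_factor j =
     (real_of_int (sylvester (j + 2)) / (real_of_int (sylvester (j + 1)) - 1)\<^sup>2) ^ (2 ^ j)"

definition esser_alpha :: real where
  "esser_alpha = 2 * (\<Prod>j. esser_factor j)"

end

theory Submission
  imports Defs
begin

text \<open>
  Write \<open>t\<^sub>j = s\<^sub>j - 1\<close> and \<open>f\<^sub>j = t\<^sub>j\<^sup>2 / s\<^bsub>j+1\<^esub> \<le> 1\<close>, so that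
  \<open>\<alpha> = 2 / L\<close>, where \<open>L\<close> is the infinite product \<open>f\<^sub>1 f\<^sub>2\<^sup>2 f\<^sub>3\<^sup>4 \<dots>\<close>. The numbers
  \<open>b\<^bsub>r+i\<^esub>\<close> are compared with \<open>s\<^bsub>r+i\<^esub>\<close>. Grouping the terms of an alternating sum over a list of
  even length in pairs shows that it is at least the product of all entries, with the last entry
  diminished by 1 (\<open>alt_sum_pairs_ge\<close>). Inserting this bound in the recursion for \<open>b\<close> and using
  \<open>t\<^sub>a s\<^sub>a \<dots> s\<^bsub>b-1\<^esub> = t\<^sub>b\<close> (\<open>sylv_telescope\<close>), one finds by induction on \<open>i\<close> that
  \<open>(b\<^bsub>r+1\<^esub> - 1) b\<^bsub>r+2\<^esub> \<dots> b\<^bsub>r+i\<^esub> \<ge> T\<^sub>i s\<^bsub>r+1\<^esub> \<dots> s\<^bsub>r+i\<^esub>\<close>, where \<open>T\<^sub>i\<close> is determined by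
  \<open>T\<^sub>1 = f\<^sub>r\<close> and \<open>T\<^bsub>i+1\<^esub> = f\<^bsub>r-i\<^esub> T\<^sub>i\<^sup>2\<close> (\<open>upper_prod_ge\<close>). In particular
  \<open>T\<^sub>r\<close> is the product of the first \<open>r\<close> factors of \<open>L\<close>, and
  \<open>T\<^bsub>r+1\<^esub> = T\<^sub>r\<^sup>2 / 3\<close>.

  The subscript list of \<open>m\<^sub>n\<close> ends in \<open>r + 1\<close>, so the pairing bound again replaces
  \<open>b\<^bsub>r+1\<^esub>\<close> by \<open>b\<^bsub>r+1\<^esub> - 1\<close>, exactly the factor in the induction. With \<open>N = n + 1\<close> this gives
  \<open>2 m\<^sub>n \<ge> T\<^sub>r t\<^sub>N\<close> for \<open>n\<close> even and \<open>m\<^sub>n \<ge> T\<^sub>r\<^sup>2 t\<^sub>N / 3\<close> for \<open>n\<close> odd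
  (\<open>esser_m_ge_even\<close>, \<open>esser_m_ge_odd\<close>); since \<open>T\<^sub>r \<ge> L\<close>, the
  two inequalities follow.

  The partial products of \<open>L\<close> decrease, and Bernoulli's inequality shows that for \<open>N \<ge> 1\<close> the product
  of the first \<open>N\<close> factors increases with \<open>N\<close> once multiplied by \<open>1 - 2\<^bsup>N+1\<^esup> / t\<^bsub>N+1\<^esub>\<close> (\<open>ratio_tower_tail_mono\<close>). This gives convergence to a positive
  limit, and five factors enclose \<open>\<alpha>\<close> to the stated accuracy.
\<close>

section \<open>Sylvester's sequence\<close>

lemma sylvester_ge_2: "2 \<le> sylvester j"
proof (induction j)
  case (Suc j)
  have "2 * 1 \<le> sylvester j * (sylvester j - 1)"
    using Suc by (intro mult_mono) auto
  then show ?case by simp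
qed simp

text \<open>Sylvester's sequence as a sequence of real numbers.\<close>

definition sylv :: "nat \<Rightarrow> real" where
  "sylv j = real_of_int (sylvester j)"

lemma sylv_ge_2: "2 \<le> sylv j"
  using sylvester_ge_2[of j] unfolding sylv_def by linarith

lemma sylv_Suc: "sylv (Suc j) - 1 = sylv j * (sylv j - 1)"
  by (simp add: sylv_def)

lemma sylv_Suc_quadratic: "sylv (Suc j) = (sylv j - 1)\<^sup>2 + (sylv j - 1) + 1"
  using sylv_Suc[of j] by (simp add: power2_eq_square algebra_simps)

lemma sylv_Suc_ge: "sylv j + 1 \<le> sylv (Suc j)"
  using sylv_Suc_quadratic[of j] sylv_ge_2[of j] one_le_power[of "sylv j - 1" 2] by linarith

lemma sylv_telescope:
  assumes "a \<le> b"
  shows "(sylv a - 1) * (\<Prod>j\<in>{a..<b}. sylv j) = sylv b - 1"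
  using assms
proof (induction b rule: dec_induct)
  case (step b)
  then have "(sylv a - 1) * (\<Prod>j\<in>{a..<Suc b}. sylv j) = (sylv b - 1) * sylv b"
    by (simp add: prod.atLeastLessThan_Suc mult.assoc[symmetric])
  then show ?case
    by (simp add: sylv_Suc mult.commute)
qed simp

text \<open>
  The number \<open>f\<^sub>j\<close>, inverse to the base of the \<open>j\<close>-th factor of the product \<open>\<alpha>\<close>.
\<close>

definition sylv_ratio :: "nat \<Rightarrow> real" where
  "sylv_ratio j = (sylv j - 1)\<^sup>2 / sylv (Suc j)"

lemma sylv_ratio_pos: "0 < sylv_ratio j"
  using sylv_ge_2[of j] sylv_ge_2[of "Suc j"] by (simp add: sylv_ratio_def)

lemma sylv_ratio_le_1: "sylv_ratio j \<le> 1"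
  using sylv_ge_2[of j] sylv_ge_2[of "Suc j"] by (simp add: sylv_ratio_def sylv_Suc_quadratic)

lemma sylv_ratio_ge: "1 - 1 / (sylv j - 1) \<le> sylv_ratio j"
proof -
  define t where "t = sylv j - 1"
  have t: "t \<ge> 1" using sylv_ge_2[of j] by (simp add: t_def)
  have "1 - 1 / t \<le> t\<^sup>2 / (t\<^sup>2 + t + 1)"
    using t by (simp add: divide_simps power2_eq_square algebra_simps add_pos_pos)
  then show ?thesis by (simp add: sylv_ratio_def sylv_Suc_quadratic t_def)
qed

text \<open>
  The product of \<open>f\<^sub>a f\<^bsub>a+1\<^esub>\<^sup>2 f\<^bsub>a+2\<^esub>\<^sup>4 \<dots>\<close> with \<open>i\<close> factors. The products for \<open>a = 1\<close> are inverse to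
  the partial products of \<open>\<alpha> / 2\<close>.
\<close>

definition ratio_tower :: "nat \<Rightarrow> nat \<Rightarrow> real" where
  "ratio_tower a i = (\<Prod>j<i. sylv_ratio (a + j) ^ 2 ^ j)"

lemma ratio_tower_Suc: "ratio_tower a (Suc i) = sylv_ratio a * (ratio_tower (Suc a) i)\<^sup>2"
  by (simp add: ratio_tower_def prod.lessThan_Suc_shift power_mult prod_power_distrib
      mult.commute[of 2] del: prod.lessThan_Suc)

lemma ratio_tower_pos: "0 < ratio_tower a i"
  by (auto simp: ratio_tower_def intro!: prod_pos zero_less_power sylv_ratio_pos)

lemma ratio_tower_le_1: "ratio_tower a i \<le> 1"
  unfolding ratio_tower_def
  by (intro prod_le_1) (auto intro!: power_le_one sylv_ratio_le_1 simp: less_imp_le[OF sylv_ratio_pos])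

section \<open>Alternating sums over lists of even length\<close>

lemma alt_sum_Nil: "alt_sum [] = 1"
  by (simp add: alt_sum_def)

lemma alt_sum_snoc: "alt_sum (xs @ [x]) = prod_list xs * x - alt_sum xs"
proof -
  have "(\<Sum>l\<le>length xs. (-1) ^ (Suc (length xs) - l) * prod_list (take l (xs @ [x])))
      = (\<Sum>l\<le>length xs. - ((-1) ^ (length xs - l) * prod_list (take l xs)))"
    by (intro sum.cong) (auto simp: Suc_diff_le)
  then show ?thesis by (simp add: alt_sum_def sum_negf)
qed

lemma alt_sum_snoc2: "alt_sum (xs @ [x, y]) = prod_list xs * x * (y - 1) + alt_sum xs"
  using alt_sum_snoc[of "xs @ [x]" y] by (simp add: alt_sum_snoc algebra_simps)

lemma prod_list_pairs:
  fixes g h :: "nat \<Rightarrow> int"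
  assumes "m \<le> n"
  shows "prod_list (concat (map (\<lambda>j. [g j, h j]) [m..<n])) = (\<Prod>j\<in>{m..<n}. g j * h j)"
  using assms by (induction n rule: dec_induct) (auto simp: prod.atLeastLessThan_Suc mult.assoc)

lemma alt_sum_pairs_ge_1:
  fixes g h :: "nat \<Rightarrow> int"
  assumes "\<And>j. j \<in> {m..<n} \<Longrightarrow> 1 \<le> g j" "\<And>j. j \<in> {m..<n} \<Longrightarrow> 1 \<le> h j"
  shows "1 \<le> alt_sum (concat (map (\<lambda>j. [g j, h j]) [m..<n]))"
  using assms
proof (induction n)
  case (Suc n)
  show ?case
  proof (cases "m \<le> n")
    case True
    have "0 \<le> (\<Prod>j\<in>{m..<n}. g j * h j)"
      using Suc.prems by (intro prod_nonneg) (force intro!: mult_nonneg_nonneg)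
    moreover have "1 \<le> g n" "1 \<le> h n"
      using Suc.prems True by auto
    ultimately have "0 \<le> (\<Prod>j\<in>{m..<n}. g j * h j) * g n * (h n - 1)"
      by simp
    with True Suc show ?thesis
      by (simp add: alt_sum_snoc2 prod_list_pairs)
  qed (simp add: alt_sum_Nil)
qed (simp add: alt_sum_Nil)

text \<open>
  The two leading terms bound the alternating sum from below, because the other terms form the
  alternating sum over the list without its last pair, which is positive.
\<close>

lemma alt_sum_pairs_ge:
  fixes g h :: "nat \<Rightarrow> int"
  assumes "m \<le> n" "\<And>j. j \<in> {m..<n} \<Longrightarrow> 1 \<le> g j" "\<And>j. j \<in> {m..<n} \<Longrightarrow> 1 \<le> h j"
  shows "(\<Prod>j\<in>{m..<n}. g j * h j) * g n * (h n - 1)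
    \<le> alt_sum (concat (map (\<lambda>j. [g j, h j]) [m..<Suc n]))"
  using alt_sum_pairs_ge_1[of m n g h, OF assms(2,3)] assms(1)
  by (simp add: alt_sum_snoc2 prod_list_pairs)

section \<open>Lower bounds for the exponents\<close>

(* The defining equations are conditional on the position of k, and expanding b in the middle of
   a list destroys its shape; they are applied explicitly where needed. *)
declare esser_b.simps [simp del]

lemma esser_b_ge_1: "1 \<le> esser_b r k"
proof (induction k rule: less_induct)
  case (less k)
  show ?case
  proof (cases "k \<le> r")
    case True
    then show ?thesis using sylvester_ge_2[of k] by (simp add: esser_b.simps(1))
  next
    case False
    have "1 \<le> alt_sum (concat (map (\<lambda>j. [esser_b r (r + j), esser_b r (r + 1 - j)]) [1..<k - r]))"
      using less False by (intro alt_sum_pairs_ge_1) auto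
    with False show ?thesis
      by (simp add: esser_b.simps(2) map_concat comp_def)
  qed
qed

text \<open>The recursion for \<open>b\<^bsub>r+i+1\<^esub>\<close>, where the pairs run over \<open>j = 1, \<dots>, i\<close>.\<close>

lemma esser_b_Suc:
  assumes "i \<le> r"
  shows "real_of_int (esser_b r (Suc (r + i))) = 1 + (sylv (r - i) - 1)\<^sup>2 *
    real_of_int (alt_sum (concat (map (\<lambda>j. [esser_b r (r + j), esser_b r (r + 1 - j)]) [1..<Suc i])))"
  using assms by (simp add: esser_b.simps map_concat comp_def sylv_def del: upt_Suc)

text \<open>
  The product \<open>(b\<^bsub>r+1\<^esub> - 1) b\<^bsub>r+2\<^esub> \<dots> b\<^bsub>r+i\<^esub>\<close>. Diminishing the first factor absorbs the loss in the
  final alternating sum, and since \<open>b\<^bsub>r+1\<^esub> - 1 = t\<^sub>r\<^sup>2 = f\<^sub>r s\<^bsub>r+1\<^esub>\<close> the induction still starts with an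
  equality.
\<close>

definition upper_prod :: "nat \<Rightarrow> nat \<Rightarrow> real" where
  "upper_prod r i = (real_of_int (esser_b r (r + 1)) - 1) *
     (\<Prod>l\<in>{2..<Suc i}. real_of_int (esser_b r (r + l)))"

lemma upper_prod_1: "upper_prod r 1 = (sylv r - 1)\<^sup>2"
  using esser_b_Suc[of 0 r] by (simp add: upper_prod_def alt_sum_Nil)

lemma upper_prod_Suc:
  "1 \<le> i \<Longrightarrow> upper_prod r (Suc i) = upper_prod r i * real_of_int (esser_b r (Suc (r + i)))"
  by (simp add: upper_prod_def prod.atLeastLessThan_Suc)

lemma upper_prod_le_prod:
  assumes "1 \<le> i"
  shows "upper_prod r i \<le> (\<Prod>l\<in>{1..<Suc i}. real_of_int (esser_b r (r + l)))"
proof -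
  have "0 \<le> (\<Prod>l\<in>{2..<Suc i}. real_of_int (esser_b r (r + l)))"
    using esser_b_ge_1[of r] by (intro prod_nonneg) (smt (verit) of_int_0_le_iff)
  moreover have "(\<Prod>l\<in>{1..<Suc i}. real_of_int (esser_b r (r + l)))
    = real_of_int (esser_b r (r + 1)) * (\<Prod>l\<in>{2..<Suc i}. real_of_int (esser_b r (r + l)))"
    using assms by (subst prod.atLeast_Suc_lessThan) (auto simp: numeral_2_eq_2)
  ultimately show ?thesis
    unfolding upper_prod_def by (simp add: algebra_simps)
qed

lemma alt_sum_ge_upper_prod:
  assumes "1 \<le> i" "i \<le> r"
  shows "upper_prod r i * (sylv (r + 1) - 1) / sylv (r + 1 - i)
    \<le> real_of_int (alt_sum (concat (map (\<lambda>j. [esser_b r (r + j), esser_b r (r + 1 - j)]) [1..<Suc i])))"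
    (is "_ \<le> real_of_int ?C")
proof -
  define t where "t = sylv (r + 1 - i) - 1"
  define B where "B = (\<Prod>l\<in>{1..<Suc i}. real_of_int (esser_b r (r + l)))"
  define S where "S = (\<Prod>j\<in>{r + 2 - i..<Suc r}. sylv j)"
  have t: "1 \<le> t" using sylv_ge_2[of "r + 1 - i"] by (simp add: t_def)
  have "(\<Prod>j\<in>{1..<i}. sylv (r + 1 - j)) = S"
    unfolding S_def using assms
    by (intro prod.reindex_bij_witness[of _ "\<lambda>j. r + 1 - j" "\<lambda>j. r + 1 - j"]) auto
  moreover have "(\<Prod>j\<in>{1..<i}. real_of_int (esser_b r (r + 1 - j))) = (\<Prod>j\<in>{1..<i}. sylv (r + 1 - j))"
    using assms by (intro prod.cong) (auto simp: sylv_def esser_b.simps(1))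
  moreover have "real_of_int (esser_b r (r + 1 - i)) = 1 + t"
    using assms by (simp add: t_def sylv_def esser_b.simps(1))
  moreover have "B = (\<Prod>j\<in>{1..<i}. real_of_int (esser_b r (r + j))) * real_of_int (esser_b r (r + i))"
    using assms by (simp add: B_def prod.atLeastLessThan_Suc)
  ultimately have eq: "real_of_int ((\<Prod>j\<in>{1..<i}. esser_b r (r + j) * esser_b r (r + 1 - j)) * esser_b r (r + i)
      * (esser_b r (r + 1 - i) - 1)) = B * S * t"
    by (simp add: prod.distrib)
  have "B * S * t \<le> ?C"
    unfolding eq[symmetric] of_int_le_iff
    using assms esser_b_ge_1 by (intro alt_sum_pairs_ge) auto
  moreover have "S * t * sylv (r + 1 - i) = sylv (r + 1) - 1"
  proof -
    have "r + 2 - i = Suc (r + 1 - i)" using assms by simp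
    then have "sylv (r + 2 - i) - 1 = sylv (r + 1 - i) * t"
      by (simp only: sylv_Suc t_def)
    moreover have "(sylv (r + 2 - i) - 1) * S = sylv (r + 1) - 1"
      using sylv_telescope[of "r + 2 - i" "Suc r"] assms by (simp only: S_def Suc_eq_plus1)
    ultimately show ?thesis by (simp add: mult_ac)
  qed
  moreover have "upper_prod r i \<le> B"
    unfolding B_def using assms by (intro upper_prod_le_prod)
  moreover have "0 \<le> S * t"
    using t by (auto simp: S_def intro!: mult_nonneg_nonneg prod_nonneg order.trans[OF _ sylv_ge_2])
  moreover have "0 < sylv (r + 1 - i)" using sylv_ge_2[of "r + 1 - i"] by linarith
  ultimately show ?thesis
    by (smt (verit) mult.assoc mult_right_mono nonzero_mult_div_cancel_right times_divide_eq_right)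
qed

text \<open>
  The main comparison. The factors \<open>t\<^bsub>r+i+1\<^esub>\<close> and \<open>t\<^bsub>r+1\<^esub>\<close> stand for the product
  \<open>s\<^bsub>r+1\<^esub> \<dots> s\<^bsub>r+i\<^esub>\<close>, which is their quotient.
\<close>

lemma upper_prod_ge:
  assumes "1 \<le> i" "i \<le> r + 1"
  shows "ratio_tower (r + 1 - i) i * (sylv (r + i + 1) - 1) \<le> upper_prod r i * (sylv (r + 1) - 1)"
  using assms
proof (induction i rule: dec_induct)
  case base
  have "sylv_ratio r * sylv (Suc r) = (sylv r - 1)\<^sup>2"
    using sylv_ge_2[of "Suc r"] by (simp add: sylv_ratio_def)
  then show ?case
    using sylv_Suc[of "Suc r"]
    by (simp add: upper_prod_1[simplified] ratio_tower_def mult.assoc[symmetric])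
next
  case (step i)
  define a where "a = r - i"
  define T where "T = ratio_tower (Suc a) i"
  define f where "f = sylv_ratio a"
  define u where "u = sylv (r + i + 1) - 1"
  define b where "b = real_of_int (esser_b r (Suc (r + i)))"
  have Suc_a: "Suc a = r + 1 - i" using step by (simp add: a_def)
  have T: "0 < T" "T \<le> 1" and f: "0 < f" "f \<le> 1"
    by (simp_all add: T_def f_def ratio_tower_pos ratio_tower_le_1 sylv_ratio_pos sylv_ratio_le_1)
  have u: "0 < u" using sylv_ge_2[of "r + i + 1"] by (simp add: u_def)
  have IH: "T * u \<le> upper_prod r i * (sylv (r + 1) - 1)"
    using step Suc_a by (simp add: T_def u_def)
  have "f * (T * u) = (sylv a - 1)\<^sup>2 * (T * u / sylv (Suc a))"
    by (simp add: f_def sylv_ratio_def)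
  also have "\<dots> \<le> (sylv a - 1)\<^sup>2 * (upper_prod r i * (sylv (r + 1) - 1) / sylv (Suc a))"
    using IH sylv_ge_2[of "Suc a"] by (intro mult_left_mono divide_right_mono) auto
  also have "\<dots> \<le> (sylv a - 1)\<^sup>2 * real_of_int (alt_sum (concat (map
      (\<lambda>j. [esser_b r (r + j), esser_b r (r + 1 - j)]) [1..<Suc i])))"
    unfolding Suc_a using step by (intro mult_left_mono alt_sum_ge_upper_prod) auto
  also have "\<dots> = b - 1"
    using esser_b_Suc[of i r] step by (simp only: a_def b_def)
  \<comment> \<open>The summand 1 in \<open>b\<close> pays for the 1 in \<open>s\<^bsub>r+i+1\<^esub> = u + 1\<close>, as \<open>f * T \<le> 1\<close>.\<close>
  finally have "f * T * u + f * T \<le> b"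
    using T f mult_le_one[of f T] by (simp add: mult.assoc)
  then have b: "f * T * (u + 1) \<le> b"
    by (simp add: algebra_simps)
  have "ratio_tower a (Suc i) * (sylv (r + Suc i + 1) - 1) = (T * u) * (f * T * (u + 1))"
    using sylv_Suc[of "r + i + 1"]
    by (simp add: ratio_tower_Suc T_def f_def u_def power2_eq_square)
  also have "\<dots> \<le> (upper_prod r i * (sylv (r + 1) - 1)) * b"
  proof (rule mult_mono[OF IH b])
    show "0 \<le> upper_prod r i * (sylv (r + 1) - 1)"
      using IH T u by (intro order.trans[OF _ IH]) simp
  qed (use T f u in simp)
  also have "\<dots> = upper_prod r (Suc i) * (sylv (r + 1) - 1)"
    using step by (simp add: upper_prod_Suc b_def)
  finally show ?case by (simp add: a_def)
qed

section \<open>Lower bounds for the numbers m\<close>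

text \<open>
  Both parities at once: the subscript list of \<open>m\<^sub>n\<close> starts with the index \<open>e = 0\<close> for \<open>n\<close> odd and
  \<open>e = 1\<close> for \<open>n\<close> even, and \<open>n + 1 = 2 * r + 2 - e\<close>.
\<close>

lemma alt_sum_outer_ge:
  assumes "e \<le> r"
  shows "ratio_tower e (r + 1 - e) * (sylv (2 * r + 2 - e) - 1) \<le> (sylv e - 1) *
    real_of_int (alt_sum (concat (map (\<lambda>j. [esser_b r j, esser_b r (2 * r + 1 - j)]) [e..<r + 1])))"
    (is "_ \<le> _ * real_of_int ?C")
proof -
  have "(\<Prod>j\<in>{e..<r}. real_of_int (esser_b r (2 * r + 1 - j)))
     = (\<Prod>l\<in>{2..<Suc (r + 1 - e)}. real_of_int (esser_b r (r + l)))"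
    using assms
    by (intro prod.reindex_bij_witness[of _ "\<lambda>l. r + 1 - l" "\<lambda>j. r + 1 - j"]) (auto simp: mult_2)
  moreover have "(\<Prod>j\<in>{e..<r}. real_of_int (esser_b r j)) * real_of_int (esser_b r r)
      = (\<Prod>j\<in>{e..<Suc r}. sylv j)"
    using assms by (auto simp: prod.atLeastLessThan_Suc sylv_def esser_b.simps(1))
  moreover have "2 * r + 1 - r = r + 1" by simp
  ultimately have eq: "real_of_int ((\<Prod>j\<in>{e..<r}. esser_b r j * esser_b r (2 * r + 1 - j)) *
      esser_b r r * (esser_b r (2 * r + 1 - r) - 1))
      = (\<Prod>j\<in>{e..<Suc r}. sylv j) * upper_prod r (r + 1 - e)"
    by (simp add: prod.distrib upper_prod_def mult_ac)
  have "(\<Prod>j\<in>{e..<Suc r}. sylv j) * upper_prod r (r + 1 - e) \<le> ?C"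
    unfolding eq[symmetric] of_int_le_iff
    using alt_sum_pairs_ge[of e r "esser_b r" "\<lambda>j. esser_b r (2 * r + 1 - j)"] assms esser_b_ge_1
    by (simp del: upt_Suc)
  then have "(sylv e - 1) * ((\<Prod>j\<in>{e..<Suc r}. sylv j) * upper_prod r (r + 1 - e)) \<le> (sylv e - 1) * ?C"
    using sylv_ge_2[of e] by (intro mult_left_mono) auto
  moreover have "(sylv e - 1) * ((\<Prod>j\<in>{e..<Suc r}. sylv j) * upper_prod r (r + 1 - e))
      = upper_prod r (r + 1 - e) * (sylv (r + 1) - 1)"
    using sylv_telescope[of e "Suc r"] assms by (simp add: mult.assoc[symmetric] mult.commute[of "upper_prod _ _"])
  moreover have "r + 1 - (r + 1 - e) = e" "r + (r + 1 - e) + 1 = 2 * r + 2 - e"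
    using assms by auto
  then have "ratio_tower e (r + 1 - e) * (sylv (2 * r + 2 - e) - 1)
      \<le> upper_prod r (r + 1 - e) * (sylv (r + 1) - 1)"
    using upper_prod_ge[of "r + 1 - e" r] assms by simp
  ultimately show ?thesis by linarith
qed

lemma esser_m_ge_even:
  assumes "1 \<le> r"
  shows "ratio_tower 1 r * (sylv (2 * r + 1) - 1) \<le> 2 * real_of_int (esser_m (2 * r))"
  using alt_sum_outer_ge[of 1 r] assms
  by (simp add: esser_m_def Let_def map_concat comp_def sylv_def del: upt_Suc)

lemma esser_m_ge_odd:
  "(ratio_tower 1 r)\<^sup>2 / 3 * (sylv (2 * r + 2) - 1) \<le> real_of_int (esser_m (2 * r + 1))"
  using alt_sum_outer_ge[of 0 r]
  by (simp add: esser_m_def Let_def map_concat comp_def sylv_def ratio_tower_Suc sylv_ratio_def del: upt_Suc)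

section \<open>The infinite product\<close>

lemma esser_factor_eq: "esser_factor j = inverse (sylv_ratio (1 + j) ^ 2 ^ j)"
  by (simp add: esser_factor_def sylv_ratio_def sylv_def power_inverse[symmetric] del: sylvester.simps)

lemma prod_esser_factor: "(\<Prod>j<N. esser_factor j) = 1 / ratio_tower 1 N"
  by (induction N) (simp_all add: esser_factor_eq ratio_tower_def divide_inverse)

text \<open>
  A bound for the relative error of the product of the first \<open>N\<close> factors. The loss caused by the
  next factor is at most \<open>2\<^sup>N / t\<^bsub>N+1\<^esub>\<close>, half of this bound, and for \<open>N \<ge> 1\<close> the bound itself at least
  halves from each step to the next.
\<close>

definition tail_bound :: "nat \<Rightarrow> real" where
  "tail_bound N = 2 ^ Suc N / (sylv (Suc N) - 1)"

lemma ratio_tower_tail_mono: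
  assumes "1 \<le> N"
  shows "ratio_tower 1 N * (1 - tail_bound N) \<le> ratio_tower 1 (Suc N) * (1 - tail_bound (Suc N))"
proof -
  define u where "u = tail_bound N"
  have t: "sylv (Suc N) - 1 \<ge> 1" using sylv_ge_2[of "Suc N"] by simp
  have s4: "4 \<le> sylv (Suc N)"
    using sylv_Suc_ge[of N] sylv_Suc_ge[of "N - 1"] sylv_ge_2[of "N - 1"] assms by simp
  have half: "tail_bound (Suc N) \<le> u / 2"
    using mult_right_mono[OF s4, of "sylv (Suc N) - 1"] t
    unfolding u_def tail_bound_def sylv_Suc[of "Suc N"]
    by (simp add: divide_simps)
  \<comment> \<open>Bernoulli's inequality, with \<open>f\<^bsub>N+1\<^esub> \<ge> 1 - 1 / t\<^bsub>N+1\<^esub>\<close>.\<close>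
  have "1 + real (2 ^ N) * (- 1 / (sylv (Suc N) - 1)) \<le> (1 + - 1 / (sylv (Suc N) - 1)) ^ 2 ^ N"
    using t by (intro Bernoulli_inequality) (simp add: divide_simps)
  also have "\<dots> \<le> sylv_ratio (Suc N) ^ 2 ^ N"
    using sylv_ratio_ge[of "Suc N"] t by (intro power_mono) (auto simp: divide_simps)
  finally have r: "1 - u / 2 \<le> sylv_ratio (Suc N) ^ 2 ^ N"
    using t by (simp add: u_def tail_bound_def field_simps)
  moreover have "sylv_ratio (Suc N) ^ 2 ^ N \<le> 1"
    using sylv_ratio_pos[of "Suc N"] sylv_ratio_le_1[of "Suc N"] by (intro power_le_one) auto
  moreover have "0 \<le> tail_bound (Suc N)"
    using sylv_ge_2[of "Suc (Suc N)"] by (simp add: tail_bound_def)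
  ultimately have "1 - u \<le> sylv_ratio (Suc N) ^ 2 ^ N * (1 - tail_bound (Suc N))"
    using half mult_right_mono[of "sylv_ratio (Suc N) ^ 2 ^ N" 1 "tail_bound (Suc N)"]
    by (simp add: algebra_simps)
  then show ?thesis
    using ratio_tower_pos[of 1 N] by (simp add: ratio_tower_def u_def mult.assoc)
qed

lemma ratio_tower_mult_mono:
  assumes "1 \<le> M" "M \<le> N"
  shows "ratio_tower 1 M * (1 - tail_bound M) \<le> ratio_tower 1 N"
proof -
  have "ratio_tower 1 M * (1 - tail_bound M) \<le> ratio_tower 1 N * (1 - tail_bound N)"
    using assms(2,1)
  proof (induction N rule: dec_induct)
    case (step k)
    then show ?case using ratio_tower_tail_mono[of k] by linarith
  qed simp
  also have "\<dots> \<le> ratio_tower 1 N"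
    using ratio_tower_pos[of 1 N] sylv_ge_2[of "Suc N"] by (simp add: tail_bound_def algebra_simps)
  finally show ?thesis .
qed

lemma ratio_tower_decseq: "decseq (ratio_tower 1)"
proof (rule decseq_SucI)
  fix N
  have "ratio_tower 1 N * sylv_ratio (1 + N) ^ 2 ^ N \<le> ratio_tower 1 N * 1"
    using sylv_ratio_pos[of "1 + N"] sylv_ratio_le_1[of "1 + N"] ratio_tower_pos[of 1 N]
    by (intro mult_left_mono power_le_one) auto
  then show "ratio_tower 1 (Suc N) \<le> ratio_tower 1 N"
    by (simp add: ratio_tower_def)
qed

lemma ratio_tower_limit:
  obtains L where "ratio_tower 1 \<longlonglongrightarrow> L" "L > 0"
    "\<And>N. L \<le> ratio_tower 1 N" "\<And>N. 1 \<le> N \<Longrightarrow> ratio_tower 1 N * (1 - tail_bound N) \<le> L"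
proof -
  have "0 \<le> ratio_tower 1 N" for N using ratio_tower_pos[of 1 N] by simp
  then obtain L where L: "ratio_tower 1 \<longlonglongrightarrow> L" "\<And>N. L \<le> ratio_tower 1 N"
    using decseq_convergent[OF ratio_tower_decseq, of 0] by metis
  have low: "ratio_tower 1 N * (1 - tail_bound N) \<le> L" if "1 \<le> N" for N
    using that by (intro LIMSEQ_le_const[OF L(1)]) (use ratio_tower_mult_mono that in blast)
  \<comment> \<open>The bound for \<open>N = 1\<close> is \<open>4 / t\<^sub>2 = 4 / 6 < 1\<close>, so the limit is positive.\<close>
  have "0 < ratio_tower 1 1 * (1 - tail_bound 1)"
    using ratio_tower_pos[of 1 1] by (simp add: tail_bound_def sylv_def eval_nat_numeral)
  also have "\<dots> \<le> L" by (rule low) simp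
  finally show ?thesis using that L low by blast
qed

lemma esser_alpha_limit:
  assumes "ratio_tower 1 \<longlonglongrightarrow> L" "L > 0"
  shows "convergent_prod esser_factor" "esser_alpha = 2 / L"
proof -
  have "(\<lambda>N. \<Prod>j<N. esser_factor j) \<longlonglongrightarrow> 1 / L"
    unfolding prod_esser_factor using assms by (intro tendsto_intros) auto
  then have *: "(\<lambda>N. \<Prod>j\<le>N. esser_factor j) \<longlonglongrightarrow> 1 / L"
    unfolding lessThan_Suc_atMost[symmetric] by (rule LIMSEQ_Suc)
  then have "esser_factor has_prod (1 / L)"
    using assms by (simp add: has_prod_def raw_has_prod_def)
  then show "convergent_prod esser_factor" "esser_alpha = 2 / L"
    by (auto simp: esser_alpha_def has_prod_iff)
qed

lemma sylv_values:
  "sylv (Suc 0) = 3" "sylv 2 = 7" "sylv 3 = 43" "sylv 4 = 1807" "sylv 5 = 3263443" "sylv 6 = 10650056950807"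
  by (simp_all add: sylv_def eval_nat_numeral)

lemma ratio_tower_5:
  "ratio_tower 1 5 = 4 / 7 * (36 / 43) ^ 2 * (1764 / 1807) ^ 4 * (3261636 / 3263443) ^ 8
    * (10650053687364 / 10650056950807) ^ 16"
proof -
  have "{..<5::nat} = {0, 1, 2, 3, 4}" by auto
  then show ?thesis
    by (simp add: ratio_tower_def sylv_ratio_def sylv_values flip: numeral_2_eq_2 numeral_3_eq_3)
qed

text \<open>
  Five factors are needed: the fifth still changes \<open>\<alpha>\<close> by more than \<open>10\<^bsup>-5\<^esup>\<close>, while \<open>tail_bound 5\<close> is
  less than \<open>10\<^bsup>-11\<^esup>\<close>.
\<close>

lemma ratio_tower_5_bounds:
  "2 / 5.5228685 < ratio_tower 1 5 * (1 - tail_bound 5)"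
  "ratio_tower 1 5 < 2 / 5.5228675"
  unfolding ratio_tower_5 by (simp_all add: tail_bound_def sylv_values power_divide)

theorem lemma8p1:
  shows "convergent_prod esser_factor \<and>
    \<bar>esser_alpha - 5.522868\<bar> < 5 / 10 ^ 7 \<and>
    (\<forall>n\<ge>2. 0 < esser_m n \<and>
      (even n \<longrightarrow>
        1 / real_of_int (esser_m n) \<le>
          esser_alpha * (1 / (real_of_int (sylvester (n + 1)) - 1))) \<and>
      (odd n \<longrightarrow>
        1 / real_of_int (esser_m n) \<le>
          3 * esser_alpha\<^sup>2 / 4 * (1 / (real_of_int (sylvester (n + 1)) - 1))))"
proof (intro conjI allI impI)
  obtain L where L: "ratio_tower 1 \<longlonglongrightarrow> L" "L > 0" "\<And>N. L \<le> ratio_tower 1 N"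
    "\<And>N. 1 \<le> N \<Longrightarrow> ratio_tower 1 N * (1 - tail_bound N) \<le> L"
    using ratio_tower_limit by blast
  note alpha = esser_alpha_limit[OF L(1,2)]
  show "convergent_prod esser_factor" by (fact alpha)
  have "2 / 5.5228685 < L" "L < 2 / 5.5228675"
    using ratio_tower_5_bounds L(3)[of 5] L(4)[of 5] by linarith+
  with L(2) have "2 / L < 5.5228685" "5.5228675 < 2 / L"
    by (simp_all add: field_simps)
  then have "2 / L - 5.522868 < 5 / 10 ^ 7" "- (2 / L - 5.522868) < 5 / 10 ^ 7"
    by simp_all
  then have "\<bar>2 / L - 5.522868\<bar> < 5 / 10 ^ 7"
    by (rule abs_less_iff[THEN iffD2, OF conjI])
  then show "\<bar>esser_alpha - 5.522868\<bar> < 5 / 10 ^ 7"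
    by (simp only: alpha)
  fix n :: nat
  assume n: "2 \<le> n"
  define r where "r = n div 2"
  define u where "u = sylv (n + 1) - 1"
  have r: "1 \<le> r" using n by (simp add: r_def)
  have u: "0 < u" using sylv_ge_2[of "n + 1"] by (simp add: u_def)
  have ev: "L * u \<le> 2 * real_of_int (esser_m n)" if "even n"
  proof -
    have "n = 2 * r" using that by (simp add: r_def)
    then show ?thesis
      using esser_m_ge_even[OF r] mult_right_mono[OF L(3)[of r], of u] u
      by (simp only: u_def) linarith
  qed
  have od: "L\<^sup>2 / 3 * u \<le> real_of_int (esser_m n)" if "odd n"
  proof -
    have n_eq: "n = 2 * r + 1" using that by (simp add: r_def)
    have "L\<^sup>2 / 3 * u \<le> (ratio_tower 1 r)\<^sup>2 / 3 * u"
      using L(2) L(3)[of r] u by (intro mult_right_mono divide_right_mono power_mono) auto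
    with n_eq show ?thesis
      using esser_m_ge_odd[of r] by (simp add: u_def del: One_nat_def)
  qed
  have pos: "0 < real_of_int (esser_m n)"
  proof (cases "even n")
    case True
    have "0 < L * u" using L(2) u by simp
    with ev[OF True] show ?thesis by linarith
  next
    case False
    have "0 < L\<^sup>2 / 3 * u" using L(2) u by simp
    with od[OF False] show ?thesis by linarith
  qed
  then show "0 < esser_m n" by simp
  have u_eq: "real_of_int (sylvester (n + 1)) - 1 = u"
    by (simp only: u_def sylv_def)
  show "1 / real_of_int (esser_m n) \<le> esser_alpha * (1 / (real_of_int (sylvester (n + 1)) - 1))"
    if "even n"
    using ev[OF that] pos u L(2) unfolding alpha u_eq by (simp add: field_simps)
  show "1 / real_of_int (esser_m n) \<le>
      3 * esser_alpha\<^sup>2 / 4 * (1 / (real_of_int (sylvester (n + 1)) - 1))"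
    if "odd n"
    using od[OF that] pos u L(2) unfolding alpha u_eq by (simp add: field_simps)
qed

end
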